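(* Let $0<\beta\le1$ and $\sqrt{2\beta}\le\alpha\le\sqrt{2(1+\sqrt{1-\beta^2})}$, and let $\nu=\alpha/\sqrt{2\beta}$. The singular spectrum of $H(\Gamma)$ which is embedded in the continuous spectrum $[-\Sigma,\infty)$ is given by the set $$\Bigl\{E_\nu(x)\in[\beta,E_{\nu,1}]:\ x\in[x_{\nu,1},\nu],\ \gamma=\omega_+\omega_-+\tfrac\beta2V_\nu(x),\ 2\omega_-=x^2U_\nu(x)\sum_{s=\pm}\omega_s(\nu^2+s)\Bigr\}.$$
   Context: Operators. In $L^2(\mathbb R^3)\otimes\mathbb C^2$ let $H=-\Delta\otimes I+i\alpha(\nabla_1\otimes\sigma_2-\nabla_2\otimes\sigma_1)+\beta I\otimes\sigma_3$ on $H^2(\mathbb R^3)\otimes\mathbb C^2$ ($\sigma_j$ Pauli matrices, $\nabla_j=\partial/\partial x_j$), self-adjoint with spectrum $[-\Sigma,\infty)$, where here $\Sigma=(\beta/\alpha)^2+(\alpha/2)^2$ (and $\Sigma\le1$ in the stated range). $H^0$ is the restriction of $H$ to $\{f\in\mathrm{dom}\,H:f(0)=0\}$. Indices $s,s'$ take values $\pm$ (identified with $\pm1$). $g_+=(1,0)^T$, $g_-=(0,1)^T$, $\psi_s=\mathcal N_s\delta\otimes g_s$ with $\delta$ the Dirac distribution at $0$ and $\mathcal N_s>0$ normalizing $\|(H-i)^{-1}\psi_s\|=1$; $\Phi_s(z)=(H-z)^{-1}\psi_s$. Each $f\in\mathrm{dom}\,H^{0*}$ is uniquely $f=\tilde f+\frac12\sum_sb_s(f)(\Phi_s(i)+\Phi_s(-i))$,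 $\tilde f\in\mathrm{dom}\,H$. $R$ is a fixed Hermitian matrix (the "admissible matrix"). $H(\Gamma)$ is the self-adjoint restriction of $H^{0*}$ to $\{f:\langle\psi,\tilde f\rangle=\Gamma b(f)\}$ (column vectors $\langle\psi,\tilde f\rangle=(\langle\psi_s,\tilde f\rangle)_s$, $b(f)=(b_s(f))_s$), with $\Gamma=(\Gamma_{ss'})$ a Hermitian $2\times2$ matrix, $\Gamma\ne-R$. Singular spectrum. It is the set of $E\in\mathbb R$ with $\det(\Gamma-Q(E))=0$, $Q_{ss'}(z)=\langle\psi_s,\frac{I+zH}{H-z}\frac1{H^2+I}\psi_{s'}\rangle$; explicitly $$\gamma=\prod_{s=\pm}\Bigl(\omega_s\pm\frac1{2\xi(E)}-\Bigl(\frac\alpha2-\frac{s\beta}\alpha\Bigr)\mathrm{artanh}(\alpha\xi(E))\Bigr)$$ (upper sign for $E<\beta$, lower for $E\ge\beta$), $\xi(E)=\frac1\beta\sqrt{\frac{-E}2(1-\sqrt{1-(\beta/E)^2})}$ (principal square roots, $\sqrt{-t}=i\sqrt t$ for $t>0$; at $E=0$ the limit $E\downarrow0$); $\mathrm{artanh}(w)=\frac12(\log(1+w)-\log(1-w))$ on $\mathbb C\setminus\{-1,1\}$ with $\mathrm{Arg}\in(-\pi,\pi]$. Here $\tilde\Gamma_{ss'}=\Gamma_{ss'}/(\mathcal N_s\mathcal N_{s'})$, $\omega_s=4\pi(\tilde\Gamma_{ss}+\Lambda_s)\in\mathbb R$, $\gamma=(4\pi|\tilde\Gamma_{+-}|)^2\ge0$,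 $\Lambda_s=\mathrm{Re}\,G_s^{\rm ren}(0;i)-\frac1{4\sqrt2\pi}$, where $G^{\rm ren}_s(0;z)=\frac{\sqrt{-z}}{4\pi}-\frac1{4\pi}\sqrt{\frac{-z}2(1+\sqrt{1-(\beta/z)^2})}+\bigl(\frac{\alpha}{8\pi}-\frac{s\beta}{4\pi\alpha}\bigr)\mathrm{artanh}\bigl(\frac\alpha\beta\sqrt{\frac{-z}2(1-\sqrt{1-(\beta/z)^2})}\bigr)$, and $\mathcal N_s^{-2}=\mathrm{Im}\,G_s^{\rm ren}(0;i)+\frac1{4\sqrt2\pi}$. Functions. For $\nu=\alpha/\sqrt{2\beta}\ge1$ define on $(0,\nu]$ $$U_\nu(x)=\frac1x\Bigl(\frac{\nu^2+1}{\nu^2}\arctan x-\frac1x\Bigr),\quad V_\nu(x)=\frac{\nu^2}{\nu^2+1}U_\nu(x)\bigl(2-(\nu^2-1)x^2U_\nu(x)\bigr),\quad E_\nu(x)=\frac{\nu^4+x^4}{2(\nu x)^2}\beta.$$ $x_{\nu,1}>0$ denotes the zero of $U_\nu$ in $(0,\nu]$ and $E_{\nu,1}=E_\nu(x_{\nu,1})$. *)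

theory Defs
  imports "HOL-Analysis.Analysis"
begin

text \<open>
  The spin index \<open>s\<close> ranges over the two-element type \<^typ>\<open>2\<close>: \<open>1\<close> is spin up (\<open>s = +\<close>) and
  the other element, written \<open>2\<close>, is spin down (\<open>s = -\<close>).
\<close>

definition sg :: "2 \<Rightarrow> real" where
  "sg s = (if s = 1 then 1 else - 1)"

definition hermitian :: "complex^2^2 \<Rightarrow> bool" where
  "hermitian A \<longleftrightarrow> (\<forall>i j. A $ i $ j = cnj (A $ j $ i))"

text \<open>
  The bottom of the spectrum \<open>[-\<Sigma>, \<infinity>)\<close> of
  \<open>H = - \<Delta> + i \<alpha> (\<nabla>\<^sub>1 \<sigma>\<^sub>2 - \<nabla>\<^sub>2 \<sigma>\<^sub>1) + \<beta> \<sigma>\<^sub>3\<close>, for \<open>\<alpha>\<^sup>2 \<ge> 2 \<beta>\<close>.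
\<close>

definition Sigma_bot :: "real \<Rightarrow> real \<Rightarrow> real" where
  "Sigma_bot \<alpha> \<beta> = (\<beta> / \<alpha>)\<^sup>2 + (\<alpha> / 2)\<^sup>2"

text \<open>
  The difference of two principal logarithms. The library function \<^const>\<open>artanh\<close> takes one
  logarithm of the quotient and has other values on the cuts. The points \<open>1\<close> and \<open>-1\<close>, where the
  totalised logarithm returns an arbitrary value, are not in the domain.
\<close>

definition cartanh :: "complex \<Rightarrow> complex" where
  "cartanh w = (Ln (1 + w) - Ln (1 - w)) / 2"

definition inner_root :: "real \<Rightarrow> complex \<Rightarrow> complex" where
  "inner_root \<beta> z = csqrt (- z / 2 * (1 - csqrt (1 - (of_real \<beta> / z)\<^sup>2)))"

definition outer_root :: "real \<Rightarrow> complex \<Rightarrow> complex" where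
  "outer_root \<beta> z = csqrt (- z / 2 * (1 + csqrt (1 - (of_real \<beta> / z)\<^sup>2)))"

text \<open>
  \<open>G_ren \<alpha> \<beta> s z\<close> is the value at the origin of the diagonal entry of the resolvent kernel of \<open>H\<close>
  minus the free kernel \<open>exp (- sqrt (- z) r) / (4 \<pi> r)\<close>, for nonreal \<open>z\<close>.
\<close>

definition G_ren :: "real \<Rightarrow> real \<Rightarrow> 2 \<Rightarrow> complex \<Rightarrow> complex" where
  "G_ren \<alpha> \<beta> s z =
     csqrt (- z) / (4 * pi) - outer_root \<beta> z / (4 * pi)
     + of_real (\<alpha> / (8 * pi) - sg s * \<beta> / (4 * pi * \<alpha>))
       * cartanh (of_real (\<alpha> / \<beta>) * inner_root \<beta> z)"

definition Lam :: "real \<Rightarrow> real \<Rightarrow> 2 \<Rightarrow> real" where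
  "Lam \<alpha> \<beta> s = Re (G_ren \<alpha> \<beta> s \<i>) - 1 / (4 * sqrt 2 * pi)"

text \<open>
  The constant making \<open>(H - i)\<^sup>-\<^sup>1 \<psi>\<^sub>s\<close> a unit vector for \<open>\<psi>\<^sub>s = \<N>\<^sub>s \<delta> \<otimes> g\<^sub>s\<close>: the squared norm of
  \<open>(H - i)\<^sup>-\<^sup>1 (\<delta> \<otimes> g\<^sub>s)\<close> is the imaginary part at \<open>z = i\<close> of the \<open>s\<close>-th diagonal resolvent kernel at
  the origin.
\<close>

definition Nrm :: "real \<Rightarrow> real \<Rightarrow> 2 \<Rightarrow> real" where
  "Nrm \<alpha> \<beta> s = 1 / sqrt (Im (G_ren \<alpha> \<beta> s \<i>) + 1 / (4 * sqrt 2 * pi))"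

text \<open>
  \<open>Q_diag \<alpha> \<beta> s z\<close> is \<open>\<langle>\<psi>\<^sub>s, (I + z H) (H - z)\<^sup>-\<^sup>1 (H\<^sup>2 + I)\<^sup>-\<^sup>1 \<psi>\<^sub>s\<rangle>\<close>. Since the operator in the middle is
  \<open>(H - z)\<^sup>-\<^sup>1 - ((H - i)\<^sup>-\<^sup>1 + (H + i)\<^sup>-\<^sup>1) / 2\<close>, this is \<open>\<N>\<^sub>s\<^sup>2\<close> times the kernel difference at the
  origin, in which the singularity cancels. The off-diagonal entries vanish because \<open>H\<close> is
  invariant under joint rotations of space and spin about the third axis.
\<close>

definition Q_diag :: "real \<Rightarrow> real \<Rightarrow> 2 \<Rightarrow> complex \<Rightarrow> complex" where
  "Q_diag \<alpha> \<beta> s z =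
     of_real ((Nrm \<alpha> \<beta> s)\<^sup>2) * (G_ren \<alpha> \<beta> s z - csqrt (- z) / (4 * pi) - of_real (Lam \<alpha> \<beta> s))"

text \<open>
  On the real axis every root and logarithm takes its principal value at the real argument
  (\<open>csqrt (- t) = i sqrt t\<close>), and \<open>E = 0\<close> is treated by the limit from the right. For \<open>E \<ge> \<beta>\<close> this is a
  convention and not the one-sided boundary value of the resolvent expression: there the two
  nested roots have boundary values of opposite sign.
\<close>

definition at_real :: "(complex \<Rightarrow> complex) \<Rightarrow> real \<Rightarrow> complex" where
  "at_real f E = (if E = 0 then Lim (at_right 0) (\<lambda>t. f (of_real t)) else f (of_real E))"

definition xi :: "real \<Rightarrow> real \<Rightarrow> complex" where
  "xi \<beta> = at_real (\<lambda>z. of_real (1 / \<beta>) * inner_root \<beta> z)"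

definition Q_mat :: "real \<Rightarrow> real \<Rightarrow> real \<Rightarrow> complex^2^2" where
  "Q_mat \<alpha> \<beta> E = (\<chi> i j. if i = j then at_real (Q_diag \<alpha> \<beta> i) E else 0)"

text \<open>
  The singular spectrum of \<open>H(\<Gamma>)\<close>. The first condition says that \<open>Q\<close> is defined at \<open>E\<close>, i.e. that the
  argument of \<^const>\<open>cartanh\<close> is admissible. It removes only the threshold \<open>E = - \<Sigma>\<close>, where \<open>Q\<close> is
  infinite.
\<close>

definition singular_spectrum :: "real \<Rightarrow> real \<Rightarrow> complex^2^2 \<Rightarrow> real set" where
  "singular_spectrum \<alpha> \<beta> \<Gamma> =
     {E. of_real \<alpha> * xi \<beta> E \<notin> {1, - 1} \<and> det (\<Gamma> - Q_mat \<alpha> \<beta> E) = 0}"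

definition Gam_tilde :: "real \<Rightarrow> real \<Rightarrow> complex^2^2 \<Rightarrow> 2 \<Rightarrow> 2 \<Rightarrow> complex" where
  "Gam_tilde \<alpha> \<beta> \<Gamma> s s' = \<Gamma> $ s $ s' / of_real (Nrm \<alpha> \<beta> s * Nrm \<alpha> \<beta> s')"

text \<open>For Hermitian \<open>\<Gamma>\<close> the diagonal entries are real, so \<^const>\<open>Re\<close> loses nothing.\<close>

definition omega :: "real \<Rightarrow> real \<Rightarrow> complex^2^2 \<Rightarrow> 2 \<Rightarrow> real" where
  "omega \<alpha> \<beta> \<Gamma> s = 4 * pi * (Re (Gam_tilde \<alpha> \<beta> \<Gamma> s s) + Lam \<alpha> \<beta> s)"

definition gam :: "real \<Rightarrow> real \<Rightarrow> complex^2^2 \<Rightarrow> real" where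
  "gam \<alpha> \<beta> \<Gamma> = (4 * pi * cmod (Gam_tilde \<alpha> \<beta> \<Gamma> 1 2))\<^sup>2"

definition U_fun :: "real \<Rightarrow> real \<Rightarrow> real" where
  "U_fun \<nu> x = 1 / x * ((\<nu>\<^sup>2 + 1) / \<nu>\<^sup>2 * arctan x - 1 / x)"

definition V_fun :: "real \<Rightarrow> real \<Rightarrow> real" where
  "V_fun \<nu> x = \<nu>\<^sup>2 / (\<nu>\<^sup>2 + 1) * U_fun \<nu> x * (2 - (\<nu>\<^sup>2 - 1) * x\<^sup>2 * U_fun \<nu> x)"

definition E_fun :: "real \<Rightarrow> real \<Rightarrow> real \<Rightarrow> real" where
  "E_fun \<beta> \<nu> x = (\<nu> ^ 4 + x ^ 4) / (2 * (\<nu> * x)\<^sup>2) * \<beta>"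

definition x_one :: "real \<Rightarrow> real" where
  "x_one \<nu> = (THE x. 0 < x \<and> x \<le> \<nu> \<and> U_fun \<nu> x = 0)"

definition E_one :: "real \<Rightarrow> real \<Rightarrow> real" where
  "E_one \<beta> \<nu> = E_fun \<beta> \<nu> (x_one \<nu>)"

subsection \<open>The determinant condition in explicit form\<close>

lemma hermitianD: "hermitian A \<Longrightarrow> A $ i $ j = cnj (A $ j $ i)"
  unfolding hermitian_def by blast

lemma csqrt_at_i: "csqrt (1 - (of_real \<beta> / \<i>)\<^sup>2) = of_real (sqrt (1 + \<beta>\<^sup>2))"
proof -
  have "1 - (of_real \<beta> / \<i>)\<^sup>2 = complex_of_real (1 + \<beta>\<^sup>2)"
    by (simp add: power_divide power_mult_distrib)
  then show ?thesis by (simp only: csqrt_of_real) (simp add: csqrt_of_real)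
qed

lemma Im_outer_root_i: "Im (outer_root \<beta> \<i>) < 0"
proof -
  have "outer_root \<beta> \<i> = csqrt (Complex 0 (- (1 + sqrt (1 + \<beta>\<^sup>2)) / 2))"
    unfolding outer_root_def csqrt_at_i
    by (intro arg_cong[where f = csqrt]) (simp add: complex_eq_iff field_simps)
  moreover have "0 < 1 + sqrt (1 + \<beta>\<^sup>2)" by (simp add: add_pos_nonneg)
  ultimately show ?thesis by (simp add: cmod_def sgn_real_def)
qed

lemma Im_inner_root_i:
  assumes "0 < \<beta>"
  shows "0 < Im (inner_root \<beta> \<i>)"
proof -
  have eq: "inner_root \<beta> \<i> = csqrt (Complex 0 ((sqrt (1 + \<beta>\<^sup>2) - 1) / 2))"
    unfolding inner_root_def csqrt_at_i
    by (intro arg_cong[where f = csqrt]) (simp add: complex_eq_iff field_simps)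
  have "1 < sqrt (1 + \<beta>\<^sup>2)" using assms by simp
  then show ?thesis unfolding eq by (simp add: cmod_def sgn_real_def)
qed

lemma Im_cartanh_nonneg:
  assumes "0 < Im w"
  shows "0 \<le> Im (cartanh w)"
proof -
  have "0 < Im (Ln (1 + w))" using Im_Ln_pos_lt_imp[of "1 + w"] assms by simp
  moreover have "Im (Ln (1 - w)) \<le> 0"
  proof (rule ccontr)
    assume "\<not> Im (Ln (1 - w)) \<le> 0"
    moreover have "1 - w \<noteq> 0" using assms by auto
    ultimately have "0 \<le> Im (1 - w)"
      using Im_Ln_pos_le[of "1 - w"] Im_Ln_le_pi[of "1 - w"] by simp
    then show False using assms by simp
  qed
  ultimately show ?thesis unfolding cartanh_def by simp
qed

lemma Im_divide_4pi: "Im (w / (4 * of_real pi)) = Im w / (4 * pi)"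
  using Im_divide_of_real[of w "4 * pi"] by (simp only: of_real_mult of_real_numeral)

lemma Nrm_pos:
  assumes "0 < \<beta>" and "sqrt (2 * \<beta>) \<le> \<alpha>"
  shows "0 < Nrm \<alpha> \<beta> s"
proof -
  define c where "c = \<alpha> / (8 * pi) - sg s * \<beta> / (4 * pi * \<alpha>)"
  define A where "A = cartanh (of_real (\<alpha> / \<beta>) * inner_root \<beta> \<i>)"
  have "0 < sqrt (2 * \<beta>)" using assms(1) by simp
  then have \<alpha>: "0 < \<alpha>" using assms(2) by linarith
  have "2 * \<beta> \<le> \<alpha>\<^sup>2" using assms(2) \<alpha> sqrt_le_D by blast
  then have c: "0 \<le> c"
    unfolding c_def using \<alpha> assms(1) by (auto simp: sg_def field_simps power2_eq_square)
  have "0 < Im (of_real (\<alpha> / \<beta>) * inner_root \<beta> \<i>)"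
    using Im_inner_root_i[OF assms(1)] \<alpha> assms(1) by (simp del: of_real_divide)
  then have A: "0 \<le> Im A" unfolding A_def by (rule Im_cartanh_nonneg)
  have f: "Im (csqrt (- \<i>)) = - (1 / sqrt 2)"
    by (simp add: real_sqrt_divide)
  have "Im (G_ren \<alpha> \<beta> s \<i>)
      = - (1 / sqrt 2) / (4 * pi) - Im (outer_root \<beta> \<i>) / (4 * pi) + c * Im A"
    unfolding G_ren_def A_def[symmetric] c_def[symmetric] plus_complex.sel minus_complex.sel
      Im_divide_4pi by (simp del: csqrt.simps add: f)
  moreover have "- (1 / sqrt 2) / (4 * pi) = - (1 / (4 * sqrt 2 * pi))" by simp
  moreover have "0 < - Im (outer_root \<beta> \<i>) / (4 * pi)"
    using Im_outer_root_i[of \<beta>] by (simp add: divide_neg_pos)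
  moreover have "0 \<le> c * Im A" using A c by simp
  ultimately have "0 < Im (G_ren \<alpha> \<beta> s \<i>) + 1 / (4 * sqrt 2 * pi)" by linarith
  then show ?thesis unfolding Nrm_def by simp
qed

lemma csqrt_nested_root:
  assumes "0 < \<beta>" and "E \<noteq> 0"
  shows "outer_root \<beta> (of_real E) * inner_root \<beta> (of_real E)
         = of_real ((if E < \<beta> then 1 else - 1) * \<beta> / 2)"
proof (cases "\<bar>E\<bar> < \<beta>")
  case False
  define r where "r = sqrt (1 - (\<beta> / E)\<^sup>2)"
  have "\<bar>\<beta> / E\<bar> \<le> 1" using False assms by (simp add: abs_divide)
  then have le: "(\<beta> / E)\<^sup>2 \<le> 1" by (simp add: abs_square_le_1)
  have cr: "csqrt (1 - (of_real \<beta> / of_real E)\<^sup>2) = of_real r"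
    unfolding r_def using le csqrt_of_real[of "1 - (\<beta> / E)\<^sup>2"] by simp
  have r: "0 \<le> r" "r \<le> 1" "r\<^sup>2 = 1 - (\<beta> / E)\<^sup>2"
    unfolding r_def using le by (auto simp: real_sqrt_le_1_iff)
  define p where "p = - E / 2 * (1 - r)"
  define q where "q = - E / 2 * (1 + r)"
  have io: "inner_root \<beta> (of_real E) = csqrt (of_real p)" "outer_root \<beta> (of_real E) = csqrt (of_real q)"
    unfolding inner_root_def outer_root_def cr p_def q_def by simp_all
  have "q * p = E\<^sup>2 / 4 * (1 - r\<^sup>2)" unfolding p_def q_def by (simp add: algebra_simps power2_eq_square)
  also have "\<dots> = (\<beta> / 2)\<^sup>2" using assms(2) unfolding r(3) by (simp add: power_divide)
  finally have qp: "q * p = (\<beta> / 2)\<^sup>2" .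
  have "sqrt \<bar>q\<bar> * sqrt \<bar>p\<bar> = sqrt \<bar>q * p\<bar>" by (simp add: abs_mult real_sqrt_mult)
  then have s: "sqrt \<bar>q\<bar> * sqrt \<bar>p\<bar> = \<beta> / 2" unfolding qp using assms(1) by simp
  show ?thesis
  proof (cases "E < 0")
    case True
    then have "0 \<le> p" "0 \<le> q" unfolding p_def q_def using r by (auto simp: mult_nonpos_nonneg)
    then have "csqrt (of_real q) * csqrt (of_real p) = of_real (sqrt \<bar>q\<bar> * sqrt \<bar>p\<bar>)"
      unfolding csqrt_of_real' by simp
    then show ?thesis unfolding io s using True assms(1) by simp
  next
    case f: False
    then have "\<beta> \<le> E" using False by simp
    have "q < 0" unfolding q_def using r f assms(2) by (auto simp: mult_pos_pos)
    moreover have "p < 0" using qp \<open>q < 0\<close> assms(1) by (metis divide_pos_pos zero_less_numeral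
        zero_less_mult_iff zero_less_power not_less_iff_gr_or_eq)
    ultimately have "csqrt (of_real q) * csqrt (of_real p) = - of_real (sqrt \<bar>q\<bar> * sqrt \<bar>p\<bar>)"
      unfolding csqrt_of_real' by (simp add: complex_eq_iff)
    then show ?thesis unfolding io s using \<open>\<beta> \<le> E\<close> by simp
  qed
next
  case True
  define r where "r = sqrt ((\<beta> / E)\<^sup>2 - 1)"
  have "1 < \<bar>\<beta> / E\<bar>" using True assms by (simp add: abs_divide)
  then have lt: "1 < (\<beta> / E)\<^sup>2" using one_less_power[of "\<bar>\<beta> / E\<bar>" 2] by (simp del: abs_divide)
  have "csqrt (of_real (1 - (\<beta> / E)\<^sup>2)) = of_real r * \<i>"
    unfolding r_def csqrt_of_real' using lt by simp
  then have cr: "csqrt (1 - (of_real \<beta> / of_real E)\<^sup>2) = of_real r * \<i>" by simp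
  have r: "0 < r" "r\<^sup>2 = (\<beta> / E)\<^sup>2 - 1" unfolding r_def using lt by auto
  define p where "p = Complex (- E / 2) (E * r / 2)"
  have io: "inner_root \<beta> (of_real E) = csqrt p" "outer_root \<beta> (of_real E) = csqrt (cnj p)"
    unfolding inner_root_def outer_root_def cr p_def
    by (intro arg_cong[where f = csqrt], simp add: complex_eq_iff)+
  have "Im p \<noteq> 0" unfolding p_def using r assms(2) by simp
  then have "p \<notin> \<real>\<^sub>\<le>\<^sub>0" by (auto simp: complex_nonpos_Reals_iff)
  then have "csqrt (cnj p) = cnj (csqrt p)" by (metis cnj_csqrt)
  then have "outer_root \<beta> (of_real E) * inner_root \<beta> (of_real E) = of_real ((cmod (csqrt p))\<^sup>2)"
    unfolding io by (simp only: complex_norm_square mult.commute)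
  also have "(cmod (csqrt p))\<^sup>2 = cmod p" by (metis norm_power power2_csqrt)
  also have "cmod p = sqrt ((\<beta> / 2)\<^sup>2)"
  proof -
    have "(- E / 2)\<^sup>2 + (E * r / 2)\<^sup>2 = E\<^sup>2 / 4 * (1 + r\<^sup>2)" by (simp add: field_simps power2_eq_square)
    also have "\<dots> = (\<beta> / 2)\<^sup>2" using assms(2) unfolding r(2) by (simp add: power_divide)
    finally show ?thesis unfolding p_def cmod_def by simp
  qed
  finally show ?thesis using True assms(1) by simp
qed

lemma nested_roots_right:
  assumes "0 < t" and "t < \<beta>"
  shows "inner_root \<beta> (of_real t) = csqrt (Complex (- t / 2) (sqrt (\<beta>\<^sup>2 - t\<^sup>2) / 2))"
    and "outer_root \<beta> (of_real t) = csqrt (Complex (- t / 2) (- sqrt (\<beta>\<^sup>2 - t\<^sup>2) / 2))"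
proof -
  define r where "r = sqrt ((\<beta> / t)\<^sup>2 - 1)"
  have "1 < (\<beta> / t)\<^sup>2" using assms by (intro one_less_power) auto
  then have "csqrt (of_real (1 - (\<beta> / t)\<^sup>2)) = of_real r * \<i>"
    unfolding r_def csqrt_of_real' by simp
  then have cr: "csqrt (1 - (of_real \<beta> / of_real t)\<^sup>2) = of_real r * \<i>" by simp
  have "(\<beta> / t)\<^sup>2 - 1 = (\<beta>\<^sup>2 - t\<^sup>2) / t\<^sup>2" using assms by (simp add: field_simps)
  then have tr: "t * r = sqrt (\<beta>\<^sup>2 - t\<^sup>2)"
    unfolding r_def using assms by (simp add: real_sqrt_divide)
  show "inner_root \<beta> (of_real t) = csqrt (Complex (- t / 2) (sqrt (\<beta>\<^sup>2 - t\<^sup>2) / 2))"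
    and "outer_root \<beta> (of_real t) = csqrt (Complex (- t / 2) (- sqrt (\<beta>\<^sup>2 - t\<^sup>2) / 2))"
    unfolding inner_root_def outer_root_def cr tr[symmetric]
    by (intro arg_cong[where f = csqrt], simp add: complex_eq_iff)+
qed

lemma nested_roots_at_0:
  assumes "0 < \<beta>"
  shows "((\<lambda>t. inner_root \<beta> (of_real t)) \<longlongrightarrow> csqrt (Complex 0 (\<beta> / 2))) (at_right 0)"
    and "((\<lambda>t. outer_root \<beta> (of_real t)) \<longlongrightarrow> csqrt (Complex 0 (- \<beta> / 2))) (at_right 0)"
proof -
  have ev: "eventually (\<lambda>t. t \<in> {0<..<\<beta>}) (at_right 0)"
    using assms by (rule eventually_at_right_real)
  have g: "((\<lambda>t. Complex (- t / 2) (c * sqrt (\<beta>\<^sup>2 - t\<^sup>2) / 2)) \<longlongrightarrow> Complex 0 (c * \<beta> / 2)) (at_right 0)"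
    for c
  proof -
    have "((\<lambda>t. Complex (- t / 2) (c * sqrt (\<beta>\<^sup>2 - t\<^sup>2) / 2))
        \<longlongrightarrow> Complex (- 0 / 2) (c * sqrt (\<beta>\<^sup>2 - 0\<^sup>2) / 2)) (at_right 0)"
      by (intro tendsto_intros) simp_all
    then show ?thesis using assms by simp
  qed
  have h: "((\<lambda>t. csqrt (Complex (- t / 2) (c * sqrt (\<beta>\<^sup>2 - t\<^sup>2) / 2)))
      \<longlongrightarrow> csqrt (Complex 0 (c * \<beta> / 2))) (at_right 0)" if "c \<noteq> 0" for c
  proof (rule isCont_tendsto_compose[OF _ g])
    show "isCont csqrt (Complex 0 (c * \<beta> / 2))"
      using that assms by (intro continuous_at_csqrt) (simp add: complex_nonpos_Reals_iff)
  qed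
  show "((\<lambda>t. inner_root \<beta> (of_real t)) \<longlongrightarrow> csqrt (Complex 0 (\<beta> / 2))) (at_right 0)"
  proof (rule Lim_transform_eventually)
    show "((\<lambda>t. csqrt (Complex (- t / 2) (sqrt (\<beta>\<^sup>2 - t\<^sup>2) / 2))) \<longlongrightarrow> csqrt (Complex 0 (\<beta> / 2))) (at_right 0)"
      using h[of "1"] by (simp del: csqrt.simps)
    show "eventually (\<lambda>t. csqrt (Complex (- t / 2) (sqrt (\<beta>\<^sup>2 - t\<^sup>2) / 2)) = inner_root \<beta> (of_real t)) (at_right 0)"
      using ev by eventually_elim (simp add: nested_roots_right del: csqrt.simps)
  qed
  show "((\<lambda>t. outer_root \<beta> (of_real t)) \<longlongrightarrow> csqrt (Complex 0 (- \<beta> / 2))) (at_right 0)"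
  proof (rule Lim_transform_eventually)
    show "((\<lambda>t. csqrt (Complex (- t / 2) (- sqrt (\<beta>\<^sup>2 - t\<^sup>2) / 2))) \<longlongrightarrow> csqrt (Complex 0 (- \<beta> / 2))) (at_right 0)"
      using h[of "- 1"] by (simp del: csqrt.simps)
    show "eventually (\<lambda>t. csqrt (Complex (- t / 2) (- sqrt (\<beta>\<^sup>2 - t\<^sup>2) / 2)) = outer_root \<beta> (of_real t)) (at_right 0)"
      using ev by eventually_elim (simp add: nested_roots_right del: csqrt.simps)
  qed
qed

lemma xi_0:
  assumes "0 < \<beta>"
  shows "xi \<beta> 0 = of_real (1 / \<beta>) * csqrt (Complex 0 (\<beta> / 2))"
  unfolding xi_def at_real_def
  by (simp del: csqrt.simps of_real_divide, rule tendsto_Lim)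
    (use assms in \<open>auto intro!: tendsto_intros nested_roots_at_0(1) simp del: csqrt.simps\<close>)

lemma Q_mat_diag:
  assumes "0 < \<beta>" and "0 < \<alpha>"
  shows "Q_mat \<alpha> \<beta> E $ s $ s = of_real ((Nrm \<alpha> \<beta> s)\<^sup>2) *
    (- (if E < \<beta> then 1 else - 1) / (2 * xi \<beta> E) / (4 * pi)
     + of_real (\<alpha> / (8 * pi) - sg s * \<beta> / (4 * pi * \<alpha>)) * cartanh (of_real \<alpha> * xi \<beta> E)
     - of_real (Lam \<alpha> \<beta> s))"
proof (cases "E = 0")
  case False
  have x: "xi \<beta> E = of_real (1 / \<beta>) * inner_root \<beta> (of_real E)"
    using False unfolding xi_def at_real_def by simp
  have n: "outer_root \<beta> (of_real E) * inner_root \<beta> (of_real E)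
      = of_real ((if E < \<beta> then 1 else - 1) * \<beta> / 2)"
    using assms(1) False by (rule csqrt_nested_root)
  then have "inner_root \<beta> (of_real E) \<noteq> 0" using assms(1) by (auto split: if_splits)
  then have o: "outer_root \<beta> (of_real E) = (if E < \<beta> then 1 else - 1) / (2 * xi \<beta> E)"
    using n assms(1) unfolding x by (auto simp: field_simps)
  have a: "of_real (\<alpha> / \<beta>) * inner_root \<beta> (of_real E) = of_real \<alpha> * xi \<beta> E"
    unfolding x by simp
  show ?thesis using False unfolding Q_mat_def at_real_def Q_diag_def G_ren_def a o by simp
next
  case True
  define L where "L = csqrt (Complex 0 (\<beta> / 2))"
  define M where "M = csqrt (Complex 0 (- \<beta> / 2))"
  define w where "w = of_real (\<alpha> / \<beta>) * L"
  note lim = nested_roots_at_0[OF assms(1), folded L_def M_def]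
  have "((\<lambda>t. outer_root \<beta> (of_real t) * inner_root \<beta> (of_real t)) \<longlongrightarrow> M * L) (at_right 0)"
    using lim by (intro tendsto_intros)
  moreover have "((\<lambda>t. outer_root \<beta> (of_real t) * inner_root \<beta> (of_real t)) \<longlongrightarrow> of_real (\<beta> / 2)) (at_right 0)"
  proof (rule tendsto_eventually)
    have "eventually (\<lambda>t. t \<in> {0<..<\<beta>}) (at_right 0)"
      using assms(1) by (rule eventually_at_right_real)
    then show "eventually (\<lambda>t. outer_root \<beta> (of_real t) * inner_root \<beta> (of_real t) = of_real (\<beta> / 2)) (at_right 0)"
      by eventually_elim (simp add: csqrt_nested_root[OF assms(1)])
  qed
  ultimately have lm: "M * L = of_real (\<beta> / 2)"
    using tendsto_unique[of "at_right (0::real)"] by (simp del: of_real_divide)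
  have "0 < Im L" unfolding L_def using assms(1) by (simp add: cmod_def sgn_real_def)
  then have w: "0 < Im w" unfolding w_def using assms by (simp del: of_real_divide)
  have x: "of_real \<alpha> * xi \<beta> E = w" "xi \<beta> E = L / of_real \<beta>"
    unfolding True xi_0[OF assms(1)] w_def L_def by simp_all
  have o: "M = (if E < \<beta> then 1 else - 1) / (2 * xi \<beta> E)"
  proof -
    have "L \<noteq> 0" using \<open>0 < Im L\<close> by auto
    then show ?thesis unfolding x using lm True assms(1) by (simp add: field_simps)
  qed
  have "isCont cartanh w"
  proof -
    have "1 + w \<notin> \<real>\<^sub>\<le>\<^sub>0" "1 - w \<notin> \<real>\<^sub>\<le>\<^sub>0" using w by (auto simp: complex_nonpos_Reals_iff)
    then show ?thesis unfolding cartanh_def by (intro continuous_intros) auto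
  qed
  then have "((\<lambda>t. cartanh (of_real (\<alpha> / \<beta>) * inner_root \<beta> (of_real t))) \<longlongrightarrow> cartanh w) (at_right 0)"
    unfolding w_def by (rule isCont_tendsto_compose) (intro tendsto_intros lim)
  then have "((\<lambda>t. of_real ((Nrm \<alpha> \<beta> s)\<^sup>2) * (- outer_root \<beta> (of_real t) / (4 * of_real pi)
        + of_real (\<alpha> / (8 * pi) - sg s * \<beta> / (4 * pi * \<alpha>))
          * cartanh (of_real (\<alpha> / \<beta>) * inner_root \<beta> (of_real t)) - of_real (Lam \<alpha> \<beta> s)))
      \<longlongrightarrow> of_real ((Nrm \<alpha> \<beta> s)\<^sup>2) * (- M / (4 * of_real pi)
        + of_real (\<alpha> / (8 * pi) - sg s * \<beta> / (4 * pi * \<alpha>)) * cartanh w - of_real (Lam \<alpha> \<beta> s)))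
      (at_right 0)"
    using lim by (intro tendsto_intros) auto
  then have "((\<lambda>t. Q_diag \<alpha> \<beta> s (of_real t))
      \<longlongrightarrow> of_real ((Nrm \<alpha> \<beta> s)\<^sup>2) * (- M / (4 * of_real pi)
        + of_real (\<alpha> / (8 * pi) - sg s * \<beta> / (4 * pi * \<alpha>)) * cartanh w - of_real (Lam \<alpha> \<beta> s)))
      (at_right 0)"
    unfolding Q_diag_def G_ren_def by (simp add: algebra_simps del: csqrt.simps)
  then have "Lim (at_right 0) (\<lambda>t. Q_diag \<alpha> \<beta> s (of_real t)) =
      of_real ((Nrm \<alpha> \<beta> s)\<^sup>2) * (- M / (4 * of_real pi)
        + of_real (\<alpha> / (8 * pi) - sg s * \<beta> / (4 * pi * \<alpha>)) * cartanh w - of_real (Lam \<alpha> \<beta> s))"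
    by (intro tendsto_Lim) auto
  then show ?thesis using True unfolding Q_mat_def at_real_def x(1) o by simp
qed

text \<open>The determinant condition written out: \<open>\<gamma> = \<Prod>\<^sub>s (\<omega>\<^sub>s \<plusminus> 1 / (2 \<xi>(E)) - \<dots>)\<close>.\<close>

theorem singular_spectrum_explicit:
  assumes "0 < \<beta>" and "sqrt (2 * \<beta>) \<le> \<alpha>" and "hermitian \<Gamma>"
  shows "E \<in> singular_spectrum \<alpha> \<beta> \<Gamma> \<longleftrightarrow>
    of_real \<alpha> * xi \<beta> E \<notin> {1, - 1} \<and>
    of_real (gam \<alpha> \<beta> \<Gamma>) =
      (\<Prod>s\<in>UNIV. of_real (omega \<alpha> \<beta> \<Gamma> s) + (if E < \<beta> then 1 else - 1) / (2 * xi \<beta> E)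
         - of_real (\<alpha> / 2 - sg s * \<beta> / \<alpha>) * cartanh (of_real \<alpha> * xi \<beta> E))"
proof -
  define N where "N = (\<lambda>s. complex_of_real (Nrm \<alpha> \<beta> s))"
  define F where "F = (\<lambda>s. of_real (omega \<alpha> \<beta> \<Gamma> s) + (if E < \<beta> then 1 else - 1) / (2 * xi \<beta> E)
         - of_real (\<alpha> / 2 - sg s * \<beta> / \<alpha>) * cartanh (of_real \<alpha> * xi \<beta> E))"
  define X where "X = (if E < \<beta> then 1 else - 1) / (2 * xi \<beta> E)"
  define A where "A = cartanh (of_real \<alpha> * xi \<beta> E)"
  have "0 < sqrt (2 * \<beta>)" using assms(1) by simp
  then have \<alpha>: "0 < \<alpha>" using assms(2) by linarith
  have N: "N s \<noteq> 0" for s unfolding N_def using Nrm_pos[OF assms(1,2), of s] by simp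
  have d: "4 * of_real pi * (\<Gamma> - Q_mat \<alpha> \<beta> E) $ s $ s = (N s)\<^sup>2 * F s" for s
  proof -
    have re: "of_real (Re (\<Gamma> $ s $ s)) = \<Gamma> $ s $ s"
      using hermitianD[OF assms(3), of s s] by (metis Reals_cnj_iff complex_is_Real_iff of_real_Re)
    have "Re (Gam_tilde \<alpha> \<beta> \<Gamma> s s) = Re (\<Gamma> $ s $ s) / (Nrm \<alpha> \<beta> s)\<^sup>2"
      unfolding Gam_tilde_def power2_eq_square by (rule Re_divide_of_real)
    then have "of_real (omega \<alpha> \<beta> \<Gamma> s)
        = 4 * of_real pi * (\<Gamma> $ s $ s / (N s)\<^sup>2 + of_real (Lam \<alpha> \<beta> s))"
      unfolding omega_def N_def by (simp add: re)
    then have F: "F s = 4 * of_real pi * (\<Gamma> $ s $ s / (N s)\<^sup>2 + of_real (Lam \<alpha> \<beta> s)) + X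
        - of_real (\<alpha> / 2 - sg s * \<beta> / \<alpha>) * A"
      unfolding F_def X_def A_def by simp
    have c: "of_real (\<alpha> / 2 - sg s * \<beta> / \<alpha>)
        = 4 * of_real pi * complex_of_real (\<alpha> / (8 * pi) - sg s * \<beta> / (4 * pi * \<alpha>))"
      using \<alpha> by (simp add: field_simps)
    have Q: "Q_mat \<alpha> \<beta> E $ s $ s = (N s)\<^sup>2 * (- X / (4 * of_real pi)
        + of_real (\<alpha> / (8 * pi) - sg s * \<beta> / (4 * pi * \<alpha>)) * A - of_real (Lam \<alpha> \<beta> s))"
      unfolding Q_mat_diag[OF assms(1) \<alpha>] X_def A_def N_def by simp
    show ?thesis
      unfolding F c vector_minus_component Q using N[of s]
      by (simp add: field_simps del: of_real_diff of_real_divide)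
  qed
  have g: "of_real (gam \<alpha> \<beta> \<Gamma>) * (N 1)\<^sup>2 * (N 2)\<^sup>2 = (4 * of_real pi)\<^sup>2 * (\<Gamma> $ 1 $ 2 * \<Gamma> $ 2 $ 1)"
  proof -
    have "\<Gamma> $ 1 $ 2 * \<Gamma> $ 2 $ 1 = of_real ((cmod (\<Gamma> $ 1 $ 2))\<^sup>2)"
      unfolding hermitianD[OF assms(3), of 2 1] by (simp only: complex_norm_square)
    moreover have "(Nrm \<alpha> \<beta> 1 * Nrm \<alpha> \<beta> 2) \<noteq> 0"
      using Nrm_pos[OF assms(1,2), of 1] Nrm_pos[OF assms(1,2), of 2] by simp
    then have "gam \<alpha> \<beta> \<Gamma> * (Nrm \<alpha> \<beta> 1)\<^sup>2 * (Nrm \<alpha> \<beta> 2)\<^sup>2 = (4 * pi)\<^sup>2 * (cmod (\<Gamma> $ 1 $ 2))\<^sup>2"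
      unfolding gam_def Gam_tilde_def
      by (simp add: norm_divide norm_mult power_mult_distrib power_divide)
    then have "of_real (gam \<alpha> \<beta> \<Gamma> * (Nrm \<alpha> \<beta> 1)\<^sup>2 * (Nrm \<alpha> \<beta> 2)\<^sup>2)
        = complex_of_real ((4 * pi)\<^sup>2 * (cmod (\<Gamma> $ 1 $ 2))\<^sup>2)" by (rule arg_cong)
    ultimately show ?thesis unfolding N_def by simp
  qed
  have "(4 * of_real pi)\<^sup>2 * det (\<Gamma> - Q_mat \<alpha> \<beta> E)
      = (4 * of_real pi * (\<Gamma> - Q_mat \<alpha> \<beta> E) $ 1 $ 1) * (4 * of_real pi * (\<Gamma> - Q_mat \<alpha> \<beta> E) $ 2 $ 2)
        - (4 * of_real pi)\<^sup>2 * (\<Gamma> $ 1 $ 2 * \<Gamma> $ 2 $ 1)"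
    unfolding det_2 by (simp add: Q_mat_def algebra_simps power2_eq_square)
  also have "\<dots> = (N 1)\<^sup>2 * (N 2)\<^sup>2 * (F 1 * F 2 - of_real (gam \<alpha> \<beta> \<Gamma>))"
    unfolding d g[symmetric] by (simp add: algebra_simps)
  finally have "det (\<Gamma> - Q_mat \<alpha> \<beta> E) = 0 \<longleftrightarrow> of_real (gam \<alpha> \<beta> \<Gamma>) = F 1 * F 2"
    using N by (metis (no_types, lifting) eq_iff_diff_eq_0 mult_eq_0_iff of_real_eq_0_iff pi_neq_zero
        power_eq_0_iff zero_neq_numeral)
  moreover have "F 1 * F 2 = (\<Prod>s\<in>UNIV. F s)" by (simp add: UNIV_2)
  ultimately show ?thesis unfolding singular_spectrum_def F_def by simp
qed

end

theory Submission
  imports Defs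
begin

text \<open>
  At \<open>\<gamma> \<ge> 0\<close> the two factors of the determinant condition have a real nonnegative product, so their
  imaginary parts cannot be nonzero and of the same sign. For \<open>- \<Sigma> < E \<le> - \<beta>\<close> both imaginary parts
  are positive because \<open>\<alpha> \<xi>(E) > 1\<close> lies on the cut of \<open>artanh\<close>; for \<open>\<bar>E\<bar> < \<beta>\<close> they have the sign
  opposite to that of \<open>Im \<xi>(E)\<close>. For \<open>E \<ge> \<beta>\<close> write \<open>E = E\<^sub>\<nu>(x)\<close> with \<open>\<alpha> \<xi>(E) = i x\<close>; the real and imaginary
  parts of the condition are the two equations of the theorem, and the imaginary parts of the
  factors are both positive when \<open>x < x\<^sub>\<nu>\<^sub>,\<^sub>1\<close>.
\<close>

section \<open>Signs of imaginary parts, and values of \<open>cartanh\<close> on the axes\<close>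

text \<open>For nonzero \<open>a\<close> the hypotheses make \<open>b\<close> a nonnegative multiple
  of \<open>cnj a\<close>, which reverses the sign of the imaginary part.\<close>

lemma Im_mult_nonpos_if_mult_nonneg:
  assumes "a * b = of_real g" and "0 \<le> g"
  shows "Im a * Im b \<le> 0"
proof (rule ccontr)
  assume "\<not> Im a * Im b \<le> 0"
  then have pos: "0 < Im a * Im b" by simp
  have re: "Re a * Re b = g + Im a * Im b" and im: "Re a * Im b = - (Im a * Re b)"
    using arg_cong[OF assms(1), of Re] arg_cong[OF assms(1), of Im] by simp_all
  \<comment> \<open>Regrouping the four factors brings in the vanishing imaginary part of
    \<open>a * b\<close>, which turns the product into minus a square.\<close>
  have "(Re a * Re b) * (Im a * Im b) = (Re a * Im b) * (Im a * Re b)" by (simp add: algebra_simps)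
  also have "\<dots> = - (Im a * Re b)\<^sup>2" unfolding im by (simp add: power2_eq_square)
  also have "\<dots> \<le> 0" by simp
  finally have "(Re a * Re b) * (Im a * Im b) \<le> 0" .
  moreover have "0 < Re a * Re b" using pos re assms(2) by linarith
  then have "0 < (Re a * Re b) * (Im a * Im b)" using pos by (rule mult_pos_pos)
  ultimately show False by simp
qed

lemma cartanh_minus: "cartanh (- w) = - cartanh w"
  unfolding cartanh_def by (simp add: field_simps)

text \<open>\<open>1 - \<i> x\<close> is the conjugate of \<open>1 + \<i> x\<close> in the right
  half plane, so the real parts of the two logarithms cancel and the imaginary parts add up to twice
  an argument.\<close>

lemma cartanh_i_times: "cartanh (\<i> * of_real x) = \<i> * of_real (arctan x)"
proof -
  define u where "u = 1 + \<i> * complex_of_real x"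
  have u: "0 < Re u" "u \<noteq> 0" "Im u / Re u = x" unfolding u_def by (auto simp: complex_eq_iff)
  then have "u \<notin> \<real>\<^sub>\<le>\<^sub>0" by (simp add: complex_nonpos_Reals_iff)
  then have c: "Ln (1 - \<i> * of_real x) = cnj (Ln u)" unfolding u_def by (simp add: cnj_Ln)
  have "Im (Ln u) = arctan x" using u by (metis Arg_eq_Im_Ln arg_conv_arctan)
  then show ?thesis unfolding cartanh_def c u_def[symmetric] by (simp add: complex_eq_iff)
qed

text \<open>This is a value on the cut: the negative number \<open>1 - x\<close> has principal
  argument \<open>pi\<close>, and its logarithm enters with a minus sign.\<close>

lemma Im_cartanh_of_real:
  assumes "1 < x"
  shows "Im (cartanh (of_real x)) = - pi / 2"
proof -
  have "Ln (1 + complex_of_real x) = of_real (ln \<bar>1 + x\<bar>)"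
    using Ln_of_real'[of "1 + x"] assms by simp
  moreover have "Ln (1 - complex_of_real x) = of_real (ln \<bar>1 - x\<bar>) + pi * \<i>"
    using Ln_of_real'[of "1 - x"] assms by simp
  ultimately show ?thesis unfolding cartanh_def by simp
qed

text \<open>Mean value theorem: the derivative of \<open>arctan\<close> at a point inside
  \<open>(0, x)\<close> exceeds its value at \<open>x\<close>.\<close>

lemma less_arctan:
  assumes "0 < x"
  shows "x / (1 + x\<^sup>2) < arctan x"
proof -
  obtain z where z: "0 < z" "z < x" "arctan x - arctan 0 = (x - 0) * inverse (1 + z\<^sup>2)"
    using MVT2[of 0 x arctan "\<lambda>y. inverse (1 + y\<^sup>2)"] assms DERIV_arctan by blast
  have "z\<^sup>2 < x\<^sup>2" using z by (intro power_strict_mono) auto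
  then have "x * inverse (1 + x\<^sup>2) < x * inverse (1 + z\<^sup>2)"
    using assms by (intro mult_strict_left_mono less_imp_inverse_less) (auto intro: add_pos_nonneg)
  then show ?thesis using z by (simp add: divide_inverse)
qed

section \<open>The functions of the parametrisation\<close>

text \<open>The factor \<open>x\<close> keeps the sign and the zeros of \<open>U_fun \<nu>\<close>
  and leaves a positive multiple of \<open>arctan\<close> plus \<open>- 1 / x\<close>, both
  increasing.\<close>

lemma times_U_fun_strict_mono:
  assumes "0 < x" and "x < y" and "\<nu> \<noteq> 0"
  shows "x * U_fun \<nu> x < y * U_fun \<nu> y"
proof -
  have "0 < (\<nu>\<^sup>2 + 1) / \<nu>\<^sup>2" using assms by (intro divide_pos_pos) (auto intro: add_nonneg_pos)
  then have "(\<nu>\<^sup>2 + 1) / \<nu>\<^sup>2 * arctan x < (\<nu>\<^sup>2 + 1) / \<nu>\<^sup>2 * arctan y"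
    using assms arctan_monotone by (intro mult_strict_left_mono) auto
  moreover have "1 / y < 1 / x" using assms by (intro divide_strict_left_mono) auto
  ultimately show ?thesis unfolding U_fun_def using assms by simp
qed

lemma U_fun_zero_exists:
  assumes "0 < \<nu>"
  shows "\<exists>x. 0 < x \<and> x \<le> \<nu> \<and> U_fun \<nu> x = 0"
proof -
  \<comment> \<open>This is \<open>x\<^sup>2 * U_fun \<nu> x\<close>, which extends continuously to
    0 with the value -1.\<close>
  define f where "f = (\<lambda>x. (\<nu>\<^sup>2 + 1) / \<nu>\<^sup>2 * (x * arctan x) - 1)"
  have "f 0 < 0" unfolding f_def by simp
  moreover have "0 \<le> f \<nu>"
  proof -
    \<comment> \<open>Replacing \<open>arctan \<nu>\<close> by its lower bound makes the first term
      of \<open>f \<nu>\<close> exactly 1.\<close>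
    have "(\<nu>\<^sup>2 + 1) / \<nu>\<^sup>2 * (\<nu> * (\<nu> / (1 + \<nu>\<^sup>2))) \<le> (\<nu>\<^sup>2 + 1) / \<nu>\<^sup>2 * (\<nu> * arctan \<nu>)"
      using less_arctan[OF assms] assms by (intro mult_left_mono) auto
    moreover have "\<nu>\<^sup>2 + 1 \<noteq> 0" by (metis add_nonneg_eq_0_iff zero_le_power2 zero_le_one zero_neq_one)
    then have "(\<nu>\<^sup>2 + 1) / \<nu>\<^sup>2 * (\<nu> * (\<nu> / (1 + \<nu>\<^sup>2))) = 1"
      using assms by (simp add: power2_eq_square add.commute)
    ultimately show ?thesis unfolding f_def by simp
  qed
  moreover have "continuous_on {0..\<nu>} f" unfolding f_def by (intro continuous_intros)
  ultimately obtain x where x: "0 \<le> x" "x \<le> \<nu>" "f x = 0"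
    using IVT'[of f 0 0 \<nu>] assms by auto
  then have "0 < x" using \<open>f 0 < 0\<close> by (cases "x = 0") auto
  moreover have "U_fun \<nu> x = f x / x\<^sup>2"
    unfolding U_fun_def f_def using \<open>0 < x\<close> by (simp add: field_simps power2_eq_square)
  ultimately show ?thesis using x by auto
qed

text \<open>The definite description denotes a zero because the strict monotonicity of
  \<open>x * U_fun \<nu> x\<close> allows only one.\<close>

lemma x_one:
  assumes "0 < \<nu>"
  shows "0 < x_one \<nu>" and "x_one \<nu> \<le> \<nu>" and "U_fun \<nu> (x_one \<nu>) = 0"
proof -
  have "\<exists>!x. 0 < x \<and> x \<le> \<nu> \<and> U_fun \<nu> x = 0"
  proof (rule ex_ex1I[OF U_fun_zero_exists[OF assms]])
    fix x y
    assume "0 < x \<and> x \<le> \<nu> \<and> U_fun \<nu> x = 0" "0 < y \<and> y \<le> \<nu> \<and> U_fun \<nu> y = 0"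
    then show "x = y"
      using times_U_fun_strict_mono[of x y \<nu>] times_U_fun_strict_mono[of y x \<nu>] assms
      by (cases x y rule: linorder_cases) auto
  qed
  from theI'[OF this] show "0 < x_one \<nu>" "x_one \<nu> \<le> \<nu>" "U_fun \<nu> (x_one \<nu>) = 0"
    unfolding x_one_def by blast+
qed

lemma U_fun_neg:
  assumes "0 < \<nu>" and "0 < x" and "x < x_one \<nu>"
  shows "U_fun \<nu> x < 0"
  using times_U_fun_strict_mono[OF assms(2,3), of \<nu>] x_one(3)[OF assms(1)] assms
  by (simp add: mult_less_0_iff)

text \<open>With \<open>t = (x / \<nu>)\<^sup>2\<close> the energy is
  \<open>\<beta> / 2 * (t + 1 / t)\<close>, which decreases on \<open>(0, 1]\<close>.\<close>

lemma E_fun_strict_antimono: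
  assumes "0 < \<beta>" and "0 < x" and "x < y" and "y \<le> \<nu>"
  shows "E_fun \<beta> \<nu> y < E_fun \<beta> \<nu> x"
proof -
  have "x\<^sup>2 < y\<^sup>2" "y\<^sup>2 \<le> \<nu>\<^sup>2" using assms by (auto intro: power_strict_mono power_mono)
  moreover have "0 < x\<^sup>2" "0 < y\<^sup>2" "0 < \<nu>\<^sup>2" using assms by auto
  moreover have "x\<^sup>2 * y\<^sup>2 < \<nu>\<^sup>2 * \<nu>\<^sup>2" using calculation by (intro mult_less_le_imp_less) auto
  ultimately have "0 < (y\<^sup>2 - x\<^sup>2) * (\<nu>\<^sup>2 * \<nu>\<^sup>2 - x\<^sup>2 * y\<^sup>2) / (2 * \<nu>\<^sup>2 * x\<^sup>2 * y\<^sup>2) * \<beta>"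
    using assms by simp
  also have "\<dots> = E_fun \<beta> \<nu> x - E_fun \<beta> \<nu> y"
    unfolding E_fun_def using assms by (simp add: field_simps power2_eq_square power4_eq_xxxx)
  finally show ?thesis by simp
qed

lemma E_fun_self: "0 < \<nu> \<Longrightarrow> E_fun \<beta> \<nu> \<nu> = \<beta>"
  unfolding E_fun_def by (simp add: power2_eq_square power4_eq_xxxx)

lemma E_fun_antimono:
  assumes "0 < \<beta>" and "0 < x" and "x \<le> y" and "y \<le> \<nu>"
  shows "E_fun \<beta> \<nu> y \<le> E_fun \<beta> \<nu> x"
  using E_fun_strict_antimono[of \<beta> x y \<nu>] assms by (cases "x = y") auto

text \<open>The equation \<open>t + 1 / t = 2 * E / \<beta>\<close> for
  \<open>t = (x / \<nu>)\<^sup>2\<close> is quadratic, and its smaller root lies in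
  \<open>(0, 1]\<close>.\<close>

lemma E_fun_surj:
  assumes "0 < \<beta>" and "0 < \<nu>" and "\<beta> \<le> E"
  obtains x where "0 < x" and "x \<le> \<nu>" and "E_fun \<beta> \<nu> x = E"
proof -
  define s where "s = sqrt (E\<^sup>2 - \<beta>\<^sup>2)"
  \<comment> \<open>The smaller root of \<open>q\<^sup>2 - 2 * E * q + \<beta>\<^sup>2 = 0\<close>,
    so that \<open>t = q / \<beta>\<close>.\<close>
  define q where "q = E - s"
  have "\<beta>\<^sup>2 \<le> E\<^sup>2" using assms by (intro power_mono) auto
  then have s: "0 \<le> s" "s\<^sup>2 = E\<^sup>2 - \<beta>\<^sup>2" unfolding s_def by auto
  have "s\<^sup>2 < E\<^sup>2" using s(2) assms(1) by simp
  then have q0: "0 < q" unfolding q_def using assms power2_less_imp_less[of s E] by simp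
  have qE: "\<beta>\<^sup>2 + q\<^sup>2 = 2 * q * E" unfolding q_def using s(2) by (simp add: power2_eq_square algebra_simps)
  have "(E - \<beta>)\<^sup>2 \<le> s\<^sup>2" unfolding s(2) using assms
    by (simp add: power2_eq_square algebra_simps)
  then have q1: "q \<le> \<beta>" unfolding q_def using s(1) power2_le_imp_le[of "E - \<beta>" s] by simp
  define x where "x = \<nu> * sqrt (q / \<beta>)"
  have x2: "x\<^sup>2 = \<nu>\<^sup>2 * (q / \<beta>)" unfolding x_def using q0 assms by (simp add: power_mult_distrib)
  have x4: "x ^ 4 = (\<nu>\<^sup>2 * (q / \<beta>))\<^sup>2" unfolding x2[symmetric] by simp
  show ?thesis
  proof
    show "0 < x" "x \<le> \<nu>" unfolding x_def using q0 q1 assms by (auto simp: mult_le_cancel_left1)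
    have "E_fun \<beta> \<nu> x = (\<beta>\<^sup>2 + q\<^sup>2) / (2 * q)"
      unfolding E_fun_def power_mult_distrib x2 x4 using q0 assms
      by (simp add: field_simps power2_eq_square power4_eq_xxxx)
    then show "E_fun \<beta> \<nu> x = E" unfolding qE using q0 by simp
  qed
qed

section \<open>The argument of \<open>artanh\<close>\<close>

text \<open>The parametrisation makes \<open>1 - (\<beta> / E)\<^sup>2\<close> the square of a
  rational function. The sign of the energy then decides whether the remaining root is taken of a
  negative or a positive real.\<close>

lemma inner_root_E_fun:
  assumes "0 < \<beta>" and "0 < x" and "x \<le> \<nu>"
  shows "inner_root \<beta> (of_real (E_fun \<beta> \<nu> x)) = \<i> * of_real (sqrt (\<beta> / 2) * x / \<nu>)"
    and "inner_root \<beta> (of_real (- E_fun \<beta> \<nu> x)) = of_real (sqrt (\<beta> / 2) * x / \<nu>)"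
proof -
  define E where "E = E_fun \<beta> \<nu> x"
  define r where "r = (\<nu> ^ 4 - x ^ 4) / (\<nu> ^ 4 + x ^ 4)"
  have pos: "0 < \<nu> ^ 4" "0 < x ^ 4" "x ^ 4 \<le> \<nu> ^ 4" using assms by (auto intro: power_mono)
  \<comment> \<open>Here \<open>x \<le> \<nu>\<close> enters: it makes \<open>r\<close> the
    principal root.\<close>
  then have r: "0 \<le> r" unfolding r_def by simp
  have sum: "\<nu> ^ 4 + x ^ 4 \<noteq> 0" using pos by linarith
  have bE: "\<beta> / E = 2 * \<nu>\<^sup>2 * x\<^sup>2 / (\<nu> ^ 4 + x ^ 4)"
    unfolding E_def E_fun_def using assms pos sum by (simp add: power_mult_distrib)
  have "(\<nu> ^ 4 - x ^ 4)\<^sup>2 = (\<nu> ^ 4 + x ^ 4)\<^sup>2 - (2 * \<nu>\<^sup>2 * x\<^sup>2)\<^sup>2"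
    by (simp add: power2_eq_square power4_eq_xxxx algebra_simps)
  then have r2: "1 - (\<beta> / E)\<^sup>2 = r\<^sup>2"
    unfolding bE r_def power_divide using sum by (simp add: diff_divide_distrib)
  have "csqrt (of_real (1 - (\<beta> / E)\<^sup>2)) = of_real r"
    unfolding r2 using r by (simp add: csqrt_of_real del: of_real_power)
  then have cr: "csqrt (1 - (of_real \<beta> / of_real E)\<^sup>2) = of_real r" by simp
  have Er: "E / 2 * (1 - r) = \<beta> / 2 * (x / \<nu>)\<^sup>2"
  proof -
    have "1 - r = 2 * x ^ 4 / (\<nu> ^ 4 + x ^ 4)" unfolding r_def using sum by (simp add: field_simps)
    then show ?thesis unfolding E_def E_fun_def using assms sum
      by (simp add: power_mult_distrib power_divide) (simp add: field_simps power2_eq_square power4_eq_xxxx)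
  qed
  have sq: "sqrt (E / 2 * (1 - r)) = sqrt (\<beta> / 2) * x / \<nu>"
    unfolding Er real_sqrt_mult using assms by simp
  have nn: "0 \<le> E / 2 * (1 - r)" unfolding Er using assms by simp
  have "inner_root \<beta> (of_real E) = csqrt (of_real (- (E / 2 * (1 - r))))"
    unfolding inner_root_def cr by simp
  also have "\<dots> = \<i> * of_real (sqrt (E / 2 * (1 - r)))"
    using nn unfolding csqrt_of_real' by (cases "E / 2 * (1 - r) = 0") auto
  finally show "inner_root \<beta> (of_real (E_fun \<beta> \<nu> x)) = \<i> * of_real (sqrt (\<beta> / 2) * x / \<nu>)"
    unfolding sq unfolding E_def .
  have "inner_root \<beta> (of_real (- E)) = csqrt (of_real (E / 2 * (1 - r)))"
    unfolding inner_root_def using cr by simp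
  also have "\<dots> = of_real (sqrt (E / 2 * (1 - r)))" using nn by (rule csqrt_of_real)
  finally show "inner_root \<beta> (of_real (- E_fun \<beta> \<nu> x)) = of_real (sqrt (\<beta> / 2) * x / \<nu>)"
    unfolding sq unfolding E_def .
qed

lemma xi_E_fun:
  assumes "0 < \<beta>" and "0 < x" and "x \<le> \<nu>" and "\<alpha> = \<nu> * sqrt (2 * \<beta>)"
  shows "of_real \<alpha> * xi \<beta> (E_fun \<beta> \<nu> x) = \<i> * of_real x"
    and "of_real \<alpha> * xi \<beta> (- E_fun \<beta> \<nu> x) = of_real x"
proof -
  have "\<beta> \<le> E_fun \<beta> \<nu> x" using E_fun_antimono[of \<beta> x \<nu> \<nu>] E_fun_self[of \<nu> \<beta>] assms by simp
  \<comment> \<open>Both energies avoid 0, where \<open>at_real\<close> would switch to a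
    limit.\<close>
  then have E: "E_fun \<beta> \<nu> x \<noteq> 0" "- E_fun \<beta> \<nu> x \<noteq> 0" using assms by auto
  have "sqrt (2 * \<beta>) * sqrt (\<beta> / 2) = \<beta>" using assms by (simp flip: real_sqrt_mult)
  then have "\<alpha> * (1 / \<beta>) * (sqrt (\<beta> / 2) * x / \<nu>) = x"
    unfolding assms(4) using assms(1-3) by (simp add: field_simps)
  then have c: "complex_of_real \<alpha> * (of_real (1 / \<beta>) * of_real (sqrt (\<beta> / 2) * x / \<nu>)) = of_real x"
    by (metis of_real_mult mult.assoc)
  show "of_real \<alpha> * xi \<beta> (E_fun \<beta> \<nu> x) = \<i> * of_real x"
    unfolding xi_def at_real_def if_not_P[OF E(1)] inner_root_E_fun(1)[OF assms(1-3)]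
    using c by (simp only: mult.left_commute[of _ \<i>])
  show "of_real \<alpha> * xi \<beta> (- E_fun \<beta> \<nu> x) = of_real x"
    unfolding xi_def at_real_def if_not_P[OF E(2)] inner_root_E_fun(2)[OF assms(1-3)] using c .
qed

text \<open>In the gap \<open>1 - (\<beta> / E)\<^sup>2\<close> is negative, so the square of the
  inner root has a nonzero imaginary part. At \<open>E = 0\<close> the limit value is
  explicit.\<close>

lemma Im_xi_nonzero:
  assumes "0 < \<beta>" and "\<bar>E\<bar> < \<beta>"
  shows "Im (xi \<beta> E) \<noteq> 0"
proof (cases "E = 0")
  case True
  have "0 < Im (csqrt (Complex 0 (\<beta> / 2)))" using assms by (simp add: cmod_def sgn_real_def)
  then show ?thesis unfolding True xi_0[OF assms(1)] using assms by (simp del: csqrt.simps of_real_divide)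
next
  case False
  define r where "r = sqrt ((\<beta> / E)\<^sup>2 - 1)"
  have "E\<^sup>2 < \<beta>\<^sup>2" using power_strict_mono[OF assms(2), of 2] by simp
  then have "1 < (\<beta> / E)\<^sup>2" using False by (simp add: power_divide)
  then have r: "0 < r" and "csqrt (of_real (1 - (\<beta> / E)\<^sup>2)) = of_real r * \<i>"
    unfolding r_def csqrt_of_real' by simp_all
  then have cr: "csqrt (1 - (of_real \<beta> / of_real E)\<^sup>2) = of_real r * \<i>" by simp
  define l where "l = inner_root \<beta> (of_real E)"
  have "l\<^sup>2 = - of_real E / 2 * (1 - of_real r * \<i>)"
    unfolding l_def inner_root_def cr by (rule power2_csqrt)
  then have "Im (l\<^sup>2) = E * r / 2" by simp
  then have "Im l \<noteq> 0" using False r by (auto simp: power2_eq_square)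
  then show ?thesis unfolding xi_def at_real_def using False assms
    by (simp add: l_def[symmetric] del: of_real_divide)
qed

section \<open>The factors of the determinant condition\<close>

lemma sg_2: "sg 2 = - 1"
  unfolding sg_def by simp

lemma sg_1: "sg 1 = 1"
  unfolding sg_def by simp

definition det_factor :: "real \<Rightarrow> real \<Rightarrow> complex^2^2 \<Rightarrow> real \<Rightarrow> 2 \<Rightarrow> complex" where
  "det_factor \<alpha> \<beta> \<Gamma> E s = of_real (omega \<alpha> \<beta> \<Gamma> s) + (if E < \<beta> then 1 else - 1) / (2 * xi \<beta> E)
     - of_real (\<alpha> / 2 - sg s * \<beta> / \<alpha>) * cartanh (of_real \<alpha> * xi \<beta> E)"

lemma singular_spectrum_iff:
  assumes "0 < \<beta>" and "sqrt (2 * \<beta>) \<le> \<alpha>" and "hermitian \<Gamma>"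
  shows "E \<in> singular_spectrum \<alpha> \<beta> \<Gamma> \<longleftrightarrow> of_real \<alpha> * xi \<beta> E \<notin> {1, - 1} \<and>
    det_factor \<alpha> \<beta> \<Gamma> E 1 * det_factor \<alpha> \<beta> \<Gamma> E 2 = of_real (gam \<alpha> \<beta> \<Gamma>)"
proof -
  have "(\<Prod>s\<in>UNIV. det_factor \<alpha> \<beta> \<Gamma> E s) = det_factor \<alpha> \<beta> \<Gamma> E 1 * det_factor \<alpha> \<beta> \<Gamma> E 2"
    by (simp add: UNIV_2)
  then show ?thesis
    unfolding singular_spectrum_explicit[OF assms] det_factor_def[symmetric] by metis
qed

text \<open>The product of the factors would have to be \<open>gam\<close>, which is a square and
  hence nonnegative.\<close>

lemma not_singular_spectrum_if_Im_same_sign: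
  assumes "0 < \<beta>" and "sqrt (2 * \<beta>) \<le> \<alpha>" and "hermitian \<Gamma>"
    and "0 < Im (det_factor \<alpha> \<beta> \<Gamma> E 1) * Im (det_factor \<alpha> \<beta> \<Gamma> E 2)"
  shows "E \<notin> singular_spectrum \<alpha> \<beta> \<Gamma>"
proof -
  have "0 \<le> gam \<alpha> \<beta> \<Gamma>" unfolding gam_def by simp
  then show ?thesis
    using Im_mult_nonpos_if_mult_nonneg[of "det_factor \<alpha> \<beta> \<Gamma> E 1" "det_factor \<alpha> \<beta> \<Gamma> E 2"] assms(4)
    unfolding singular_spectrum_iff[OF assms(1-3)] by force
qed

text \<open>From \<open>\<alpha>\<^sup>2 = 2 * \<beta> * \<nu>\<^sup>2\<close>. The new form shows
  the sign of the coefficient at \<open>c = sg s\<close> by comparing \<open>sg s\<close> with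
  \<open>\<nu>\<^sup>2\<close>.\<close>

lemma cartanh_coeff:
  assumes "0 < \<beta>" and "0 < \<nu>" and "\<alpha> = \<nu> * sqrt (2 * \<beta>)"
  shows "\<alpha> / 2 - c * \<beta> / \<alpha> = \<alpha> / 2 * (1 - c / \<nu>\<^sup>2)"
proof -
  have "\<alpha>\<^sup>2 = 2 * \<beta> * \<nu>\<^sup>2" unfolding assms(3) using assms(1) by (simp add: power_mult_distrib)
  then have "\<beta> = \<alpha>\<^sup>2 / (2 * \<nu>\<^sup>2)" using assms(2) by simp
  then have "\<beta> / \<alpha> = \<alpha> / 2 / \<nu>\<^sup>2" by (simp add: power2_eq_square)
  then have "c * \<beta> / \<alpha> = c * (\<alpha> / 2 / \<nu>\<^sup>2)" by (metis times_divide_eq_right)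
  then show ?thesis by (simp add: algebra_simps)
qed

text \<open>At \<open>\<alpha> \<xi> = \<i> x\<close> both \<open>1 / \<xi>\<close> and
  \<open>cartanh\<close> are purely imaginary, so \<open>omega\<close> is the real part. The
  imaginary part is rewritten by eliminating \<open>arctan x\<close> in favour of
  \<open>U_fun \<nu> x\<close>.\<close>

lemma det_factor_E_fun:
  assumes "0 < \<beta>" and "0 < x" and "x \<le> \<nu>" and "\<alpha> = \<nu> * sqrt (2 * \<beta>)"
  shows "det_factor \<alpha> \<beta> \<Gamma> (E_fun \<beta> \<nu> x) 1 = Complex (omega \<alpha> \<beta> \<Gamma> 1)
      (\<alpha> / (2 * (\<nu>\<^sup>2 + 1) * x) * (2 - (\<nu>\<^sup>2 - 1) * x\<^sup>2 * U_fun \<nu> x))"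
    and "det_factor \<alpha> \<beta> \<Gamma> (E_fun \<beta> \<nu> x) 2 = Complex (omega \<alpha> \<beta> \<Gamma> 2) (- (\<alpha> / 2 * x * U_fun \<nu> x))"
proof -
  define u where "u = U_fun \<nu> x"
  have \<nu>: "0 < \<nu>" and \<alpha>: "0 < \<alpha>" using assms by auto
  have "\<beta> \<le> E_fun \<beta> \<nu> x" using E_fun_antimono[of \<beta> x \<nu> \<nu>] E_fun_self[of \<nu> \<beta>] assms by simp
  \<comment> \<open>The lower sign applies on the whole range, including \<open>x = \<nu>\<close>,
    where the energy equals \<beta>.\<close>
  then have nl: "\<not> E_fun \<beta> \<nu> x < \<beta>" by simp
  have w: "of_real \<alpha> * xi \<beta> (E_fun \<beta> \<nu> x) = \<i> * of_real x" by (rule xi_E_fun(1)[OF assms])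
  then have xi: "xi \<beta> (E_fun \<beta> \<nu> x) = \<i> * of_real x / of_real \<alpha>" using \<alpha> by (simp add: field_simps)
  have "- 1 / (2 * xi \<beta> (E_fun \<beta> \<nu> x)) = \<i> * of_real (\<alpha> / (2 * x))"
    unfolding xi using \<alpha> assms(2) by (simp add: field_simps)
  then have f: "det_factor \<alpha> \<beta> \<Gamma> (E_fun \<beta> \<nu> x) s = Complex (omega \<alpha> \<beta> \<Gamma> s)
      (\<alpha> / 2 * (1 / x - (1 - sg s / \<nu>\<^sup>2) * arctan x))" for s
    unfolding det_factor_def w cartanh_i_times if_not_P[OF nl] cartanh_coeff[OF assms(1) \<nu> assms(4)]
    by (simp add: complex_eq_iff algebra_simps del: of_real_diff of_real_divide of_real_mult)
  have u: "u = 1 / x * ((1 + 1 / \<nu>\<^sup>2) * arctan x - 1 / x)"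
    unfolding u_def U_fun_def using \<nu> by (simp add: add_divide_distrib)
  have A2: "1 / x - (1 + 1 / \<nu>\<^sup>2) * arctan x = - (x * u)"
    unfolding u using assms(2) by simp
  have A1: "1 / x - (1 - 1 / \<nu>\<^sup>2) * arctan x = (2 - (\<nu>\<^sup>2 - 1) * x\<^sup>2 * u) / ((\<nu>\<^sup>2 + 1) * x)"
  proof -
    have "0 < \<nu>\<^sup>2 + 1" by (simp add: add_nonneg_pos)
    then have d: "(\<nu>\<^sup>2 + 1) * x \<noteq> 0" using assms(2) by simp
    \<comment> \<open>These relations let \<open>algebra\<close> treat the two reciprocals as
      variables of their own.\<close>
    have n: "\<nu>\<^sup>2 * (1 / \<nu>\<^sup>2) = 1" "x * (1 / x) = 1" using \<nu> assms(2) by simp_all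
    have "(1 / x - (1 - 1 / \<nu>\<^sup>2) * arctan x) * ((\<nu>\<^sup>2 + 1) * x) = 2 - (\<nu>\<^sup>2 - 1) * x\<^sup>2 * u"
      unfolding u using n by algebra
    then show ?thesis using d by (metis nonzero_eq_divide_eq)
  qed
  show "det_factor \<alpha> \<beta> \<Gamma> (E_fun \<beta> \<nu> x) 1 = Complex (omega \<alpha> \<beta> \<Gamma> 1)
      (\<alpha> / (2 * (\<nu>\<^sup>2 + 1) * x) * (2 - (\<nu>\<^sup>2 - 1) * x\<^sup>2 * U_fun \<nu> x))"
    unfolding f sg_1 A1 u_def[symmetric] by simp
  show "det_factor \<alpha> \<beta> \<Gamma> (E_fun \<beta> \<nu> x) 2 = Complex (omega \<alpha> \<beta> \<Gamma> 2) (- (\<alpha> / 2 * x * U_fun \<nu> x))"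
    unfolding f sg_2 using A2 by (simp add: u_def)
qed

section \<open>The determinant condition for energies from \<beta> upwards\<close>

text \<open>The two equations are the real and the imaginary part of the complex condition, the
  latter divided by a positive factor.\<close>

lemma E_fun_in_singular_spectrum_iff:
  assumes "0 < \<beta>" and "1 \<le> \<nu>" and "0 < x" and "x \<le> \<nu>" and "\<alpha> = \<nu> * sqrt (2 * \<beta>)" and "hermitian \<Gamma>"
  shows "E_fun \<beta> \<nu> x \<in> singular_spectrum \<alpha> \<beta> \<Gamma> \<longleftrightarrow>
    gam \<alpha> \<beta> \<Gamma> = omega \<alpha> \<beta> \<Gamma> 1 * omega \<alpha> \<beta> \<Gamma> 2 + \<beta> / 2 * V_fun \<nu> x \<and>
    2 * omega \<alpha> \<beta> \<Gamma> 2 = x\<^sup>2 * U_fun \<nu> x * (\<Sum>s\<in>UNIV. omega \<alpha> \<beta> \<Gamma> s * (\<nu>\<^sup>2 + sg s))"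
proof -
  define u where "u = U_fun \<nu> x"
  define o1 where "o1 = omega \<alpha> \<beta> \<Gamma> 1"
  define o2 where "o2 = omega \<alpha> \<beta> \<Gamma> 2"
  define a1 where "a1 = \<alpha> / (2 * (\<nu>\<^sup>2 + 1) * x) * (2 - (\<nu>\<^sup>2 - 1) * x\<^sup>2 * u)"
  define a2 where "a2 = - (\<alpha> / 2 * x * u)"
  have \<alpha>: "0 < \<alpha>" "sqrt (2 * \<beta>) \<le> \<alpha>" using assms by auto
  have \<alpha>2: "\<alpha> * \<alpha> = 2 * \<beta> * \<nu>\<^sup>2"
    using assms(1) unfolding assms(5) by (simp add: power2_eq_square)
  have p: "0 < \<nu>\<^sup>2 + 1" by (simp add: add_nonneg_pos)
  have w: "of_real \<alpha> * xi \<beta> (E_fun \<beta> \<nu> x) = \<i> * of_real x"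
    by (rule xi_E_fun(1)[OF assms(1,3,4,5)])
  have "of_real \<alpha> * xi \<beta> (E_fun \<beta> \<nu> x) \<notin> {1, - 1}" unfolding w by (auto simp: complex_eq_iff)
  then have "E_fun \<beta> \<nu> x \<in> singular_spectrum \<alpha> \<beta> \<Gamma> \<longleftrightarrow>
      Complex o1 a1 * Complex o2 a2 = of_real (gam \<alpha> \<beta> \<Gamma>)"
    unfolding singular_spectrum_iff[OF assms(1) \<alpha>(2) assms(6)] det_factor_E_fun[OF assms(1,3,4,5)]
      o1_def o2_def a1_def a2_def u_def by simp
  also have "\<dots> \<longleftrightarrow> gam \<alpha> \<beta> \<Gamma> = o1 * o2 - a1 * a2 \<and> o1 * a2 + a1 * o2 = 0"
    by (auto simp: complex_eq_iff)
  also have "- (a1 * a2) = \<beta> / 2 * V_fun \<nu> x"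
  proof -
    \<comment> \<open>The letters \<open>d\<close> and \<open>k\<close> stand for
      \<open>\<nu>\<^sup>2 + 1\<close> and the bracket of \<open>V_fun\<close>, which are to stay
      unexpanded.\<close>
    have "- (\<alpha> / (2 * d * x) * k * - (\<alpha> / 2 * x * u)) = (\<alpha> * \<alpha>) / (4 * d) * u * k"
      if "d \<noteq> 0" for d k
      using that assms(3) by (simp add: field_simps)
    then have "- (a1 * a2) = (\<alpha> * \<alpha>) / (4 * (\<nu>\<^sup>2 + 1)) * u * (2 - (\<nu>\<^sup>2 - 1) * x\<^sup>2 * u)"
      unfolding a1_def a2_def using p by (metis less_irrefl)
    moreover have "\<alpha> * \<alpha> / (4 * d) = \<beta> / 2 * (\<nu>\<^sup>2 / d)" for d unfolding \<alpha>2 by simp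
    ultimately have "- (a1 * a2) = \<beta> / 2 * (\<nu>\<^sup>2 / (\<nu>\<^sup>2 + 1)) * u * (2 - (\<nu>\<^sup>2 - 1) * x\<^sup>2 * u)"
      by (simp only:)
    then show ?thesis unfolding V_fun_def u_def by (simp only: mult.assoc)
  qed
  then have "o1 * o2 - a1 * a2 = o1 * o2 + \<beta> / 2 * V_fun \<nu> x" by simp
  also have "o1 * a2 + a1 * o2 = 0 \<longleftrightarrow> 2 * o2 = x\<^sup>2 * u * (o1 * (\<nu>\<^sup>2 + 1) + o2 * (\<nu>\<^sup>2 - 1))"
  proof -
    \<comment> \<open>Here \<open>d\<close> and \<open>k\<close> stand for
      \<open>\<nu>\<^sup>2 + 1\<close> and \<open>\<nu>\<^sup>2 - 1\<close>.\<close>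
    have "o1 * - (\<alpha> / 2 * x * u) + \<alpha> / (2 * d * x) * (2 - k * x\<^sup>2 * u) * o2
        = \<alpha> / (2 * d * x) * (2 * o2 - x\<^sup>2 * u * (o1 * d + o2 * k))"
      if "d \<noteq> 0" for d k
      using that assms(3) by (simp add: field_simps power2_eq_square)
    then have "o1 * a2 + a1 * o2 = \<alpha> / (2 * (\<nu>\<^sup>2 + 1) * x)
        * (2 * o2 - x\<^sup>2 * u * (o1 * (\<nu>\<^sup>2 + 1) + o2 * (\<nu>\<^sup>2 - 1)))"
      unfolding a1_def a2_def using p by (metis less_irrefl)
    then show ?thesis using \<alpha>(1) assms(3) p by simp
  qed
  finally show ?thesis unfolding o1_def o2_def u_def by (simp add: UNIV_2 sg_1 sg_2)
qed

text \<open>To the left of \<open>x_one \<nu>\<close> the function \<open>U_fun \<nu>\<close> is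
  negative. This makes the imaginary part for spin down positive, and for spin up, as
  \<open>\<nu> \<ge> 1\<close>, the bracket is at least 2.\<close>

lemma x_one_le_if_singular:
  assumes "0 < \<beta>" and "1 \<le> \<nu>" and "0 < x" and "x \<le> \<nu>" and "\<alpha> = \<nu> * sqrt (2 * \<beta>)" and "hermitian \<Gamma>"
    and "E_fun \<beta> \<nu> x \<in> singular_spectrum \<alpha> \<beta> \<Gamma>"
  shows "x_one \<nu> \<le> x"
proof (rule ccontr)
  assume "\<not> x_one \<nu> \<le> x"
  then have u: "U_fun \<nu> x < 0" using U_fun_neg[of \<nu> x] assms by simp
  have \<alpha>: "0 < \<alpha>" "sqrt (2 * \<beta>) \<le> \<alpha>" using assms by auto
  have "1 \<le> \<nu>\<^sup>2" using assms(2) by simp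
  then have "(\<nu>\<^sup>2 - 1) * x\<^sup>2 * U_fun \<nu> x \<le> 0" using u by (intro mult_nonneg_nonpos) auto
  moreover have "0 < \<alpha> / (2 * (\<nu>\<^sup>2 + 1) * x)" using \<alpha> assms(3) by (simp add: add_nonneg_pos)
  moreover have "\<alpha> / 2 * x * U_fun \<nu> x < 0" using \<alpha> assms(3) u by (intro mult_pos_neg) auto
  ultimately have "0 < Im (det_factor \<alpha> \<beta> \<Gamma> (E_fun \<beta> \<nu> x) 1) * Im (det_factor \<alpha> \<beta> \<Gamma> (E_fun \<beta> \<nu> x) 2)"
    unfolding det_factor_E_fun[OF assms(1,3,4,5)] complex.sel by (intro mult_pos_pos) auto
  then show False
    using not_singular_spectrum_if_Im_same_sign[OF assms(1) \<alpha>(2) assms(6)] assms(7) by blast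
qed

section \<open>Exclusion of the energies below \<beta>\<close>

text \<open>Inversion exchanges the half planes, \<open>cartanh\<close> keeps the closed ones, and
  its coefficient is nonnegative and enters with a minus sign. Both terms thus push the imaginary
  part the same way for either spin.\<close>

lemma not_singular_spectrum_in_gap:
  assumes "0 < \<beta>" and "sqrt (2 * \<beta>) \<le> \<alpha>" and "hermitian \<Gamma>" and "\<bar>E\<bar> < \<beta>"
  shows "E \<notin> singular_spectrum \<alpha> \<beta> \<Gamma>"
proof (rule not_singular_spectrum_if_Im_same_sign[OF assms(1-3)])
  define \<xi> where "\<xi> = xi \<beta> E"
  define A where "A = cartanh (of_real \<alpha> * \<xi>)"
  have "0 < sqrt (2 * \<beta>)" using assms(1) by simp
  then have \<alpha>: "0 < \<alpha>" using assms(2) by linarith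
  have "2 * \<beta> \<le> \<alpha>\<^sup>2" using assms(2) \<alpha> sqrt_le_D by blast
  then have k: "0 \<le> \<alpha> / 2 - sg s * \<beta> / \<alpha>" for s
    unfolding sg_def using \<alpha> assms(1) by (auto simp: field_simps power2_eq_square)
  have f: "Im (det_factor \<alpha> \<beta> \<Gamma> E s) = Im (1 / (2 * \<xi>)) - (\<alpha> / 2 - sg s * \<beta> / \<alpha>) * Im A" for s
    unfolding det_factor_def \<xi>_def A_def using assms(4)
    by (simp del: of_real_diff of_real_divide of_real_mult)
  have I: "Im (1 / (2 * z)) < 0" if "0 < Im z" for z
    using that by (auto simp: Im_divide intro!: divide_pos_pos add_nonneg_pos)
  have "Im \<xi> \<noteq> 0" unfolding \<xi>_def using assms by (intro Im_xi_nonzero)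
  then consider "0 < Im \<xi>" | "0 < Im (- \<xi>)" by fastforce
  then show "0 < Im (det_factor \<alpha> \<beta> \<Gamma> E 1) * Im (det_factor \<alpha> \<beta> \<Gamma> E 2)"
  proof cases
    case 1
    then have "0 \<le> Im A" unfolding A_def using \<alpha> by (intro Im_cartanh_nonneg) simp
    then have "0 \<le> (\<alpha> / 2 - sg s * \<beta> / \<alpha>) * Im A" for s using k by (intro mult_nonneg_nonneg)
    \<comment> \<open>Strictness comes from \<open>1 / (2 * \<xi>)\<close> alone; the coefficient of
      \<open>cartanh\<close> vanishes for spin up when
      \<open>\<alpha>\<^sup>2 = 2 * \<beta>\<close>.\<close>
    then have "Im (det_factor \<alpha> \<beta> \<Gamma> E s) < 0" for s unfolding f using I[OF 1] by (smt (verit))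
    then show ?thesis by (intro mult_neg_neg)
  next
    case 2
    \<comment> \<open>Oddness of \<open>cartanh\<close> brings this case back to the upper half
      plane.\<close>
    then have "0 \<le> Im (cartanh (- (of_real \<alpha> * \<xi>)))"
      using \<alpha> by (intro Im_cartanh_nonneg) (simp add: mult_less_0_iff)
    then have "Im A \<le> 0" unfolding cartanh_minus A_def by simp
    then have "(\<alpha> / 2 - sg s * \<beta> / \<alpha>) * Im A \<le> 0" for s using k by (intro mult_nonneg_nonpos)
    moreover have "0 < Im (1 / (2 * \<xi>))" using I[OF 2] by simp
    ultimately have "0 < Im (det_factor \<alpha> \<beta> \<Gamma> E s)" for s unfolding f by (smt (verit))
    then show ?thesis by (intro mult_pos_pos)
  qed
qed

text \<open>Writing \<open>- E = E_fun \<beta> \<nu> x\<close> gives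
  \<open>\<alpha> \<xi> = x\<close>, and the threshold corresponds to \<open>x = 1\<close>. Beyond
  it \<open>1 / \<xi>\<close> is real, so only the constant \<open>- pi / 2\<close> from the cut
  contributes to the imaginary parts.\<close>

lemma not_singular_spectrum_below_gap:
  assumes "0 < \<beta>" and "1 \<le> \<nu>" and "\<alpha> = \<nu> * sqrt (2 * \<beta>)" and "hermitian \<Gamma>"
    and "- Sigma_bot \<alpha> \<beta> \<le> E" and "E \<le> - \<beta>"
  shows "E \<notin> singular_spectrum \<alpha> \<beta> \<Gamma>"
proof -
  have \<nu>: "0 < \<nu>" using assms by simp
  have \<alpha>: "0 < \<alpha>" "sqrt (2 * \<beta>) \<le> \<alpha>" using assms by auto
  have \<alpha>2: "\<alpha>\<^sup>2 = 2 * \<beta> * \<nu>\<^sup>2" using assms(1) unfolding assms(3) by (simp add: power_mult_distrib)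
  obtain x where x: "0 < x" "x \<le> \<nu>" "E_fun \<beta> \<nu> x = - E"
    using E_fun_surj[OF assms(1) \<nu>, of "- E"] assms(6) by auto
  have w: "of_real \<alpha> * xi \<beta> E = of_real x"
    using xi_E_fun(2)[OF assms(1) x(1,2) assms(3)] unfolding x(3) by simp
  have "Sigma_bot \<alpha> \<beta> = E_fun \<beta> \<nu> 1"
    unfolding Sigma_bot_def E_fun_def power_divide \<alpha>2 using assms(1) \<nu>
    by (simp add: field_simps power2_eq_square power4_eq_xxxx)
  then have "1 \<le> x"
    using E_fun_strict_antimono[OF assms(1) x(1) _ assms(2)] x(3) assms(5) by (cases "x < 1") auto
  show ?thesis
  proof (cases "x = 1")
    \<comment> \<open>At the threshold the argument of \<open>cartanh\<close> is 1, which the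
      definition of the singular spectrum excludes.\<close>
    case True
    then show ?thesis unfolding singular_spectrum_iff[OF assms(1) \<alpha>(2) assms(4)] w by simp
  next
    case False
    then have x1: "1 < x" using \<open>1 \<le> x\<close> by simp
    have "xi \<beta> E = of_real (x / \<alpha>)" using w \<alpha> by (simp add: field_simps)
    then have "Im ((if E < \<beta> then 1 else - 1) / (2 * xi \<beta> E)) = 0" by simp
    then have f: "Im (det_factor \<alpha> \<beta> \<Gamma> E s) = \<alpha> / 2 * (1 - sg s / \<nu>\<^sup>2) * (pi / 2)" for s
      unfolding det_factor_def w cartanh_coeff[OF assms(1) \<nu> assms(3)]
      by (simp add: Im_cartanh_of_real[OF x1] del: of_real_diff of_real_divide of_real_mult)
    \<comment> \<open>\<open>1 < x \<le> \<nu>\<close> makes the coefficient strictly positive for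
      spin up as well.\<close>
    have "1 < \<nu>\<^sup>2" using x1 x(2) by simp
    then have "sg s < \<nu>\<^sup>2" for s unfolding sg_def by auto
    then have "0 < 1 - sg s / \<nu>\<^sup>2" for s using \<nu> by (simp add: divide_less_eq)
    then have "0 < Im (det_factor \<alpha> \<beta> \<Gamma> E s)" for s unfolding f using \<alpha>(1) by simp
    then show ?thesis
      by (intro not_singular_spectrum_if_Im_same_sign[OF assms(1) \<alpha>(2) assms(4)] mult_pos_pos)
  qed
qed

theorem theorem6p8:
  fixes \<alpha> \<beta> \<nu> :: real and \<Gamma> R :: "complex^2^2"
  assumes "0 < \<beta>" and "\<beta> \<le> 1"
    and "sqrt (2 * \<beta>) \<le> \<alpha>" and "\<alpha> \<le> sqrt (2 * (1 + sqrt (1 - \<beta>\<^sup>2)))"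
    and "\<nu> = \<alpha> / sqrt (2 * \<beta>)"
    and "hermitian R" and "hermitian \<Gamma>" and "\<Gamma> \<noteq> - R"
  shows "singular_spectrum \<alpha> \<beta> \<Gamma> \<inter> {- Sigma_bot \<alpha> \<beta>..} =
    {E_fun \<beta> \<nu> x | x.
       E_fun \<beta> \<nu> x \<in> {\<beta>..E_one \<beta> \<nu>} \<and> x \<in> {x_one \<nu>..\<nu>} \<and>
       gam \<alpha> \<beta> \<Gamma> = omega \<alpha> \<beta> \<Gamma> 1 * omega \<alpha> \<beta> \<Gamma> 2 + \<beta> / 2 * V_fun \<nu> x \<and>
       2 * omega \<alpha> \<beta> \<Gamma> 2 =
         x\<^sup>2 * U_fun \<nu> x * (\<Sum>s\<in>UNIV. omega \<alpha> \<beta> \<Gamma> s * (\<nu>\<^sup>2 + sg s))}"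
    (is "?L = {E_fun \<beta> \<nu> x | x. ?P x}")
proof -
  have "0 < sqrt (2 * \<beta>)" using assms(1) by simp
  then have \<nu>: "1 \<le> \<nu>" and \<alpha>: "\<alpha> = \<nu> * sqrt (2 * \<beta>)" using assms(3,5) by auto
  then have \<nu>0: "0 < \<nu>" by simp
  note iff = E_fun_in_singular_spectrum_iff[OF assms(1) \<nu> _ _ \<alpha> assms(7)]
  show ?thesis
  proof (rule set_eqI, rule iffI)
    fix E
    assume E: "E \<in> ?L"
    then have "\<beta> \<le> E"
      using not_singular_spectrum_in_gap[OF assms(1,3,7), of E]
        not_singular_spectrum_below_gap[OF assms(1) \<nu> \<alpha> assms(7), of E] by force
    obtain x where x: "0 < x" "x \<le> \<nu>" "E_fun \<beta> \<nu> x = E"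
      using \<open>\<beta> \<le> E\<close> by (rule E_fun_surj[OF assms(1) \<nu>0])
    have S: "E_fun \<beta> \<nu> x \<in> singular_spectrum \<alpha> \<beta> \<Gamma>" using E x by simp
    have le: "x_one \<nu> \<le> x" by (rule x_one_le_if_singular[OF assms(1) \<nu> x(1,2) \<alpha> assms(7) S])
    \<comment> \<open>The energy decreases in \<open>x\<close>, so the lower bound on
      \<open>x\<close> becomes the upper bound on the energy.\<close>
    have "E_fun \<beta> \<nu> x \<le> E_one \<beta> \<nu>"
      unfolding E_one_def using x_one[OF \<nu>0] le x by (intro E_fun_antimono[OF assms(1)])
    then have "?P x" using S le x \<open>\<beta> \<le> E\<close> unfolding iff[OF x(1,2)] by simp
    then show "E \<in> {E_fun \<beta> \<nu> x | x. ?P x}" using x(3) by blast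
  next
    fix E
    assume "E \<in> {E_fun \<beta> \<nu> x | x. ?P x}"
    then obtain x where x: "E = E_fun \<beta> \<nu> x" "?P x" by blast
    have "0 < x" "x \<le> \<nu>" using x(2) x_one(1)[OF \<nu>0] by auto
    then have "E \<in> singular_spectrum \<alpha> \<beta> \<Gamma>" unfolding x(1) using x(2) by (subst iff) auto
    \<comment> \<open>Energies from \<beta> > 0 upwards therefore lie in the continuous
      spectrum.\<close>
    moreover have "- Sigma_bot \<alpha> \<beta> \<le> 0" unfolding Sigma_bot_def by simp
    then have "- Sigma_bot \<alpha> \<beta> \<le> E" using x assms(1) by auto
    ultimately show "E \<in> ?L" by simp
  qed
qed

end
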